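(* Let $(\gamma_+,\gamma_-)$ be an angularly regular parallel pair of cooriented frontal germs in $\mathbb{R}^2$ with common angular parameter $u$ near $0$: $\gamma_+'=\rho_+\mathbf e$, $\gamma_-'=-\rho_-\mathbf e$. Put $\Sigma_\rho=\rho_++\rho_-$, $\Delta_\gamma=\gamma_+-\gamma_-$, $\mathcal J_\rho=\rho_+\rho_-'-\rho_-\rho_+'$, assume $\det(\Delta_\gamma(0),\mathbf e(0))\neq0$ and $\Sigma_\rho(0)\neq0$, and let $S(u)=\gamma_-(u)+\frac{\rho_-(u)}{\Sigma_\rho(u)}\Delta_\gamma(u)$ be the local centre symmetry set branch. If $S$ has a $3/2$-cusp at $0$, then its cuspidal curvature is $$\omega_S=\frac{2\,\Sigma_\rho(0)\det(\Delta_\gamma(0),\mathbf e(0))}{\sqrt{\left|\left(\frac{\rho_-}{\Sigma_\rho}\right)''(0)\right|}\;|\Delta_\gamma(0)|^{5/2}},\qquad\text{where}\qquad \left(\frac{\rho_-}{\Sigma_\rho}\right)''(0)=\frac{\mathcal J_\rho'(0)}{\Sigma_\rho(0)^2}.$$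
   Context: A smooth germ $\gamma:(\mathbb R,0)\to\mathbb R^2$ is a cooriented frontal if it has a smooth unit normal field $\mathbf n$ with $\gamma'\cdot\mathbf n=0$; choosing the unit tangent field $\mathbf e=(\cos\theta,\sin\theta)$ so that $(\mathbf e,\mathbf n)$ is positively oriented, $\gamma'=\ell\mathbf e$ with smooth $\ell,\theta$. It is angularly regular if $\theta'\neq0$. Angularly regular parallel pair: two angularly regular cooriented frontal germs $\gamma_\pm$ whose tangent lines at the base points are parallel, tangent lifts chosen opposite at the base points. Both are parametrised by a common angular parameter $u$ near $0$, with $\gamma_+'(u)=\rho_+(u)\mathbf e(u)$, $\gamma_-'(u)=-\rho_-(u)\mathbf e(u)$, where $\mathbf e(u)=(\cos(u+\theta_0),\sin(u+\theta_0))$ for a constant $\theta_0$, and $\rho_\pm$ are smooth (extended signed radii of curvature, possibly vanishing). Prime denotes $d/du$. The local centre symmetry set branch is the envelope of the chord lines $\gamma_-(u)+\lambda\Delta_\gamma(u)$, parametrised under the stated assumptions by $S$. A $3/2$-cusp is a germ that becomes $t\mapsto(t^2,t^3)$ after smooth diffeomorphism germs in source and target. For a germ $f:(\mathbb R,0)\to\mathbb R^2$ with $f'(0)=0$, $f''(0)\neq0$, the cuspidal curvature is $\omega_f=\det(f''(0),f'''(0))/|f''(0)|^{5/2}$. *)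

theory Defs
  imports "HOL-Analysis.Analysis"
begin

text \<open>
  Germs at a point are represented by total functions, of which only the behaviour near that
  point matters. For open \<open>U\<close> in finite dimension, \<open>Ck_on k f U\<close> says that \<open>f\<close> is of class
  \<open>C\<^sup>k\<close> on \<open>U\<close>, by recursion on directional derivatives.
\<close>

primrec Ck_on :: "nat \<Rightarrow> ('a::euclidean_space \<Rightarrow> 'b::euclidean_space) \<Rightarrow> 'a set \<Rightarrow> bool" where
  "Ck_on 0 f U \<longleftrightarrow> continuous_on U f"
| "Ck_on (Suc k) f U \<longleftrightarrow>
     (\<forall>x\<in>U. f differentiable (at x)) \<and> (\<forall>v. Ck_on k (\<lambda>x. frechet_derivative f (at x) v) U)"

definition smooth_on :: "('a::euclidean_space \<Rightarrow> 'b::euclidean_space) \<Rightarrow> 'a set \<Rightarrow> bool" where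
  "smooth_on f U \<longleftrightarrow> (\<forall>k. Ck_on k f U)"

definition smooth_germ :: "('a::euclidean_space \<Rightarrow> 'b::euclidean_space) \<Rightarrow> 'a \<Rightarrow> bool" where
  "smooth_germ f a \<longleftrightarrow> (\<exists>U. open U \<and> a \<in> U \<and> smooth_on f U)"

definition diffeo_germ :: "('a::euclidean_space \<Rightarrow> 'a) \<Rightarrow> 'a \<Rightarrow> 'a \<Rightarrow> bool" where
  "diffeo_germ \<phi> a b \<longleftrightarrow>
     \<phi> a = b \<and>
     (\<exists>U V \<psi>. open U \<and> open V \<and> a \<in> U \<and> homeomorphism U V \<phi> \<psi> \<and>
        smooth_on \<phi> U \<and> smooth_on \<psi> V)"

definition vderiv :: "(real \<Rightarrow> real^2) \<Rightarrow> real \<Rightarrow> real^2" where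
  "vderiv f = (\<lambda>t. vector_derivative f (at t))"

definition det2 :: "real^2 \<Rightarrow> real^2 \<Rightarrow> real" where
  "det2 v w = det (vector [v, w] :: real^2^2)"

definition unit_dir :: "real \<Rightarrow> real^2" where
  "unit_dir \<alpha> = vector [cos \<alpha>, sin \<alpha>]"

definition cooriented_frontal :: "(real \<Rightarrow> real^2) \<Rightarrow> (real \<Rightarrow> real^2) \<Rightarrow> bool" where
  "cooriented_frontal \<gamma> n \<longleftrightarrow>
     smooth_germ \<gamma> 0 \<and> smooth_germ n 0 \<and>
     (\<forall>\<^sub>F t in nhds 0. norm (n t) = 1 \<and> vderiv \<gamma> t \<bullet> n t = 0)"

text \<open>
  \<open>\<theta>\<close> is an angle function of the unit tangent field \<open>e\<close> such that \<open>(e, n)\<close> is a positively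
  oriented orthonormal frame.
\<close>

definition tangent_angle :: "(real \<Rightarrow> real^2) \<Rightarrow> (real \<Rightarrow> real) \<Rightarrow> bool" where
  "tangent_angle n \<theta> \<longleftrightarrow>
     smooth_germ \<theta> 0 \<and>
     (\<forall>\<^sub>F t in nhds 0. unit_dir (\<theta> t) \<bullet> n t = 0 \<and> det2 (unit_dir (\<theta> t)) (n t) > 0)"

definition angularly_regular ::
    "(real \<Rightarrow> real^2) \<Rightarrow> (real \<Rightarrow> real^2) \<Rightarrow> (real \<Rightarrow> real) \<Rightarrow> bool" where
  "angularly_regular \<gamma> n \<theta> \<longleftrightarrow>
     cooriented_frontal \<gamma> n \<and> tangent_angle n \<theta> \<and> deriv \<theta> 0 \<noteq> 0"

text \<open>
  The two tangent angles differ by \<open>\<pi>\<close>: the tangent lines at equal parameters are parallel and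
  the tangent lifts are opposite, so the speed of \<open>\<gamma>\<^sub>-\<close> along its own lift \<open>- e\<close> is \<open>\<rho>\<^sub>-\<close>.
\<close>

definition angularly_regular_parallel_pair ::
    "(real \<Rightarrow> real^2) \<Rightarrow> (real \<Rightarrow> real^2) \<Rightarrow> (real \<Rightarrow> real) \<Rightarrow> (real \<Rightarrow> real) \<Rightarrow> real \<Rightarrow> bool" where
  "angularly_regular_parallel_pair \<gamma>p \<gamma>m \<rho>p \<rho>m \<theta>0 \<longleftrightarrow>
     (\<exists>np. angularly_regular \<gamma>p np (\<lambda>u. u + \<theta>0)) \<and>
     (\<exists>nm. angularly_regular \<gamma>m nm (\<lambda>u. u + \<theta>0 + pi)) \<and>
     smooth_germ \<rho>p 0 \<and> smooth_germ \<rho>m 0 \<and>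
     (\<forall>\<^sub>F u in nhds 0.
        vderiv \<gamma>p u = \<rho>p u *\<^sub>R unit_dir (u + \<theta>0) \<and>
        vderiv \<gamma>m u = - \<rho>m u *\<^sub>R unit_dir (u + \<theta>0))"

definition three_halves_cusp :: "(real \<Rightarrow> real^2) \<Rightarrow> bool" where
  "three_halves_cusp f \<longleftrightarrow>
     smooth_germ f 0 \<and>
     (\<exists>\<phi> \<Psi>. diffeo_germ \<phi> 0 0 \<and> diffeo_germ \<Psi> (f 0) 0 \<and>
        (\<forall>\<^sub>F t in nhds 0. \<Psi> (f (\<phi> t)) = vector [t^2, t^3]))"

text \<open>
  A relation rather than a function, so that asserting a value of the cuspidal curvature
  includes that it is defined, i.e. \<open>f'(0) = 0\<close> and \<open>f''(0) \<noteq> 0\<close>.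
\<close>

definition has_cuspidal_curvature :: "(real \<Rightarrow> real^2) \<Rightarrow> real \<Rightarrow> bool" where
  "has_cuspidal_curvature f \<omega> \<longleftrightarrow>
     vderiv f 0 = 0 \<and> (vderiv ^^ 2) f 0 \<noteq> 0 \<and>
     \<omega> = det2 ((vderiv ^^ 2) f 0) ((vderiv ^^ 3) f 0) / norm ((vderiv ^^ 2) f 0) powr (5/2)"

end

theory Submission
  imports Defs
begin

text \<open>
  Since \<open>\<Delta>' = \<Sigma>\<^sub>\<rho> e\<close>, the tangential terms cancel and \<open>S' = \<mu>' \<Delta>\<close> with
  \<open>\<mu> = \<rho>\<^sub>- / \<Sigma>\<^sub>\<rho>\<close> and \<open>\<mu>' = J / \<Sigma>\<^sub>\<rho>\<^sup>2\<close>. A \<open>3/2\<close>-cusp has vanishing first and nonvanishing second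
  derivative, so \<open>\<mu>'(0) = 0 \<noteq> \<mu>''(0)\<close>. Hence at \<open>0\<close> we have \<open>S'' = \<mu>'' \<Delta>\<close> and
  \<open>S''' = \<mu>''' \<Delta> + 2 \<mu>'' \<Sigma>\<^sub>\<rho> e\<close>, from which the curvature can be read off.
\<close>

section \<open>Derivatives of smooth germs\<close>

lemma smooth_germ_vector_derivative:
  fixes f :: "real \<Rightarrow> 'b::euclidean_space"
  assumes "smooth_germ f a"
  obtains g where "smooth_germ g a" "\<forall>\<^sub>F x in nhds a. (f has_vector_derivative g x) (at x)"
proof -
  obtain U where U: "open U" "a \<in> U" "\<And>k. Ck_on k f U"
    using assms by (auto simp: smooth_germ_def smooth_on_def)
  \<comment> \<open>On the real line the direction 1 determines the whole Frechet derivative by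
    linearity. Since \<open>?g\<close> is again of every class on the same \<open>U\<close>, the
    result can be iterated for higher derivatives.\<close>
  let ?g = "\<lambda>x. frechet_derivative f (at x) 1"
  have diff: "\<forall>x\<in>U. f differentiable (at x)" and smooth: "\<And>k. Ck_on k ?g U"
    using U(3)[of "Suc k" for k] by auto
  have "(f has_vector_derivative ?g x) (at x)" if "x \<in> U" for x
  proof -
    have D: "(f has_derivative frechet_derivative f (at x)) (at x)"
      using diff that by (simp add: frechet_derivative_works)
    then interpret bounded_linear "frechet_derivative f (at x)"
      by (rule has_derivative_bounded_linear)
    have "frechet_derivative f (at x) = (\<lambda>h. h *\<^sub>R ?g x)"
      by (metis mult.right_neutral real_scaleR_def scaleR)
    with D show ?thesis by (simp add: has_vector_derivative_def)
  qed
  then have "\<forall>\<^sub>F x in nhds a. (f has_vector_derivative ?g x) (at x)"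
    using U eventually_nhds by blast
  moreover have "smooth_germ ?g a"
    using U smooth by (auto simp: smooth_germ_def smooth_on_def)
  ultimately show ?thesis using that by blast
qed

lemma smooth_germ_real_derivative:
  fixes f :: "real \<Rightarrow> real"
  assumes "smooth_germ f a"
  obtains g where "smooth_germ g a" "\<forall>\<^sub>F x in nhds a. (f has_real_derivative g x) (at x)"
  using smooth_germ_vector_derivative[OF assms, folded has_real_derivative_iff_has_vector_derivative] .

lemma has_vector_derivative_eventually_eq:
  assumes "(g has_vector_derivative D) (at t)" "\<forall>\<^sub>F s in nhds t. f s = g s"
  shows "(f has_vector_derivative D) (at t)"
proof -
  have "\<forall>\<^sub>F s in at t. g s = f s"
    using assms(2) by (auto simp: eventually_at_filter elim: eventually_mono)
  then show ?thesis
    using assms(1) eventually_nhds_x_imp_x[OF assms(2)]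
      has_derivative_transform_eventually[of g _ t UNIV f]
    unfolding has_vector_derivative_def by simp
qed

text \<open>Near \<open>a\<close>, the equality of \<open>f\<close> and \<open>g\<close> holds on a
  whole neighbourhood of each \<open>t\<close>, so it passes to derivatives. Hypothesis and
  conclusion have the same eventual form, which permits repeated differentiation.\<close>

lemma vderiv_eventually:
  assumes "\<forall>\<^sub>F t in nhds a. f t = g t" "\<forall>\<^sub>F t in nhds a. (g has_vector_derivative h t) (at t)"
  shows "\<forall>\<^sub>F t in nhds a. vderiv f t = h t"
  using eventually_eventually[THEN iffD2, OF assms(1)] assms(2)
proof eventually_elim
  case (elim t)
  show ?case
    unfolding vderiv_def
    by (intro vector_derivative_at has_vector_derivative_eventually_eq[OF elim(2,1)])
qed

lemma deriv_eventually:
  assumes "\<forall>\<^sub>F t in nhds a. f t = g t" "\<forall>\<^sub>F t in nhds a. (g has_real_derivative h t) (at t)"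
  shows "\<forall>\<^sub>F t in nhds a. deriv f t = h t"
  using eventually_eventually[THEN iffD2, OF assms(1)] assms(2)
proof eventually_elim
  case (elim t)
  then show ?case
    by (metis DERIV_imp_deriv deriv_cong_ev)
qed

section \<open>Local estimates and the derivatives of a cusp\<close>

lemma smooth_on_imp_differentiable: "smooth_on f U \<Longrightarrow> x \<in> U \<Longrightarrow> f differentiable (at x)"
  using Ck_on.simps(2)[of 0 f U] by (auto simp: smooth_on_def simp del: Ck_on.simps)

text \<open>The chain rule applied to \<open>\<psi> \<circ> \<phi> = id\<close> near
  \<open>a\<close> gives \<open>D\<close> a left inverse.\<close>

lemma diffeo_germ_derivative:
  assumes "diffeo_germ \<phi> a b"
  obtains D where "(\<phi> has_derivative D) (at a)" "inj D"
proof -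
  obtain U V \<psi> where U: "open U" "open V" "a \<in> U" "homeomorphism U V \<phi> \<psi>"
      "smooth_on \<phi> U" "smooth_on \<psi> V"
    using assms by (auto simp: diffeo_germ_def)
  have "\<phi> a \<in> V" using U by (auto simp: homeomorphism_def)
  then obtain D E where D: "(\<phi> has_derivative D) (at a)" and E: "(\<psi> has_derivative E) (at (\<phi> a))"
    using U smooth_on_imp_differentiable unfolding differentiable_def by meson
  have "((\<psi> \<circ> \<phi>) has_derivative (E \<circ> D)) (at a)"
    by (rule diff_chain_at[OF D E])
  moreover have "\<forall>\<^sub>F x in at a. (\<psi> \<circ> \<phi>) x = x"
    using U by (auto simp: eventually_at_topological homeomorphism_def)
  moreover have "(\<psi> \<circ> \<phi>) a = a" using U by (auto simp: homeomorphism_def)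
  ultimately have "((\<lambda>x. x) has_derivative (E \<circ> D)) (at a)"
    using has_derivative_transform_eventually[of "\<psi> \<circ> \<phi>" "E \<circ> D" a UNIV "\<lambda>x. x"] by auto
  then have "E \<circ> D = (\<lambda>x. x)"
    using has_derivative_unique has_derivative_ident by blast
  then have "inj D" by (metis inj_on_id2 inj_on_imageI2)
  with D that show ?thesis by blast
qed

text \<open>The linear part is bounded by some \<open>K\<close> and the remainder by
  \<open>norm (x - a)\<close>, so \<open>C = K + 1\<close> works. Such bounds carry
  order-of-vanishing estimates through coordinate changes.\<close>

lemma has_derivative_Lipschitz_at:
  assumes "(f has_derivative D) (at a)"
  obtains C where "C > 0" "\<forall>\<^sub>F x in nhds a. norm (f x - f a) \<le> C * norm (x - a)"
proof -
  obtain K where K: "K > 0" "\<And>x. norm (D x) \<le> norm x * K"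
    using bounded_linear.pos_bounded[OF has_derivative_bounded_linear[OF assms]] by blast
  obtain d where d: "d > 0"
    "\<And>y. norm (y - a) < d \<Longrightarrow> norm (f y - f a - D (y - a)) \<le> 1 * norm (y - a)"
    using assms unfolding has_derivative_at_alt by (meson zero_less_one)
  have "norm (f y - f a) \<le> (K + 1) * norm (y - a)" if "dist y a < d" for y
    using d(2)[of y] K(2)[of "y - a"] that norm_triangle_sub[of "f y - f a" "D (y - a)"]
    by (simp add: dist_norm algebra_simps)
  then have "\<forall>\<^sub>F y in nhds a. norm (f y - f a) \<le> (K + 1) * norm (y - a)"
    using d(1) eventually_nhds_metric by blast
  with K(1) that[of "K + 1"] show ?thesis by simp
qed

text \<open>Since \<open>f1\<close> vanishes at 0 together with its derivative,
  \<open>norm (f1 t) \<le> \<epsilon> * \<bar>t\<bar>\<close> near 0. The mean value inequality on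
  the interval of radius \<open>\<bar>s\<bar>\<close> then supplies the second factor
  \<open>\<bar>s\<bar>\<close>.\<close>

lemma second_order_vanishing:
  fixes f :: "real \<Rightarrow> 'b::real_normed_vector"
  assumes "\<forall>\<^sub>F t in nhds 0. (f has_vector_derivative f1 t) (at t)"
    and "(f1 has_vector_derivative 0) (at 0)" "f1 0 = 0" "\<epsilon> > 0"
  shows "\<forall>\<^sub>F s in nhds 0. norm (f s - f 0) \<le> \<epsilon> * s\<^sup>2"
proof -
  obtain d1 where d1: "d1 > 0" "\<And>t. \<bar>t\<bar> < d1 \<Longrightarrow> (f has_vector_derivative f1 t) (at t)"
    using assms(1) unfolding eventually_nhds_metric by (auto simp: dist_norm)
  obtain d2 where d2: "d2 > 0" "\<And>t. \<bar>t\<bar> < d2 \<Longrightarrow> norm (f1 t) \<le> \<epsilon> * \<bar>t\<bar>"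
    using assms(2-4) unfolding has_vector_derivative_def has_derivative_at_alt by fastforce
  have "norm (f s - f 0) \<le> \<epsilon> * s\<^sup>2" if "dist s 0 < min d1 d2" for s
  proof -
    have s: "\<bar>t\<bar> < d1" "\<bar>t\<bar> < d2" if "t \<in> cball 0 \<bar>s\<bar>" for t
      using that \<open>dist s 0 < min d1 d2\<close> by (auto simp: dist_norm)
    have "norm (f s - f 0) \<le> (\<epsilon> * \<bar>s\<bar>) * norm (s - 0)"
    proof (rule differentiable_bound)
      show "(f has_derivative (\<lambda>h. h *\<^sub>R f1 t)) (at t within cball 0 \<bar>s\<bar>)"
        if "t \<in> cball 0 \<bar>s\<bar>" for t
        using d1(2)[OF s(1)[OF that]] has_derivative_at_withinI
        unfolding has_vector_derivative_def by blast
      show "onorm (\<lambda>h. h *\<^sub>R f1 t) \<le> \<epsilon> * \<bar>s\<bar>" if "t \<in> cball 0 \<bar>s\<bar>" for t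
      proof (rule onorm_le)
        fix h :: real
        have "norm (f1 t) \<le> \<epsilon> * \<bar>s\<bar>"
          using d2(2)[OF s(2)[OF that]] that \<open>\<epsilon> > 0\<close>
          by (auto intro: order_trans mult_left_mono)
        then show "norm (h *\<^sub>R f1 t) \<le> \<epsilon> * \<bar>s\<bar> * norm h"
          by (simp add: mult.commute[of _ "\<bar>h\<bar>"] mult_left_mono)
      qed
    qed auto
    then show ?thesis by (simp add: power2_eq_square mult.assoc)
  qed
  moreover have "min d1 d2 > 0" using d1 d2 by simp
  ultimately show ?thesis unfolding eventually_nhds_metric by blast
qed

text \<open>
  For the second-order part, \<open>f''(0) = 0\<close> would give \<open>f s - f 0 = o(s\<^sup>2)\<close>, and this
  survives the two coordinate changes, whereas the model \<open>(t\<^sup>2, t\<^sup>3)\<close> has norm at least \<open>t\<^sup>2\<close>.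
\<close>

lemma three_halves_cusp_derivatives:
  assumes cusp: "three_halves_cusp f"
    and f1: "\<forall>\<^sub>F t in nhds 0. (f has_vector_derivative f1 t) (at t)"
    and f2: "(f1 has_vector_derivative f2) (at 0)"
  shows "f1 0 = 0" "f2 \<noteq> 0"
proof -
  obtain \<phi> \<Psi> where \<phi>: "diffeo_germ \<phi> 0 0" and \<Psi>: "diffeo_germ \<Psi> (f 0) 0"
    and eq: "\<forall>\<^sub>F t in nhds 0. \<Psi> (f (\<phi> t)) = vector [t^2, t^3]"
    using cusp by (auto simp: three_halves_cusp_def)
  obtain D where D: "(\<phi> has_derivative D) (at 0)" "inj D"
    using diffeo_germ_derivative[OF \<phi>] .
  obtain E where E: "(\<Psi> has_derivative E) (at (f 0))" "inj E"
    using diffeo_germ_derivative[OF \<Psi>] .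
  have \<phi>0: "\<phi> 0 = 0" and \<Psi>0: "\<Psi> (f 0) = 0"
    using \<phi> \<Psi> by (auto simp: diffeo_germ_def)
  have f0: "(f has_derivative (\<lambda>h. h *\<^sub>R f1 0)) (at 0)"
    using eventually_nhds_x_imp_x[OF f1] by (simp add: has_vector_derivative_def)
  show f10: "f1 0 = 0"
  proof -
    \<comment> \<open>The same composite is differentiated twice over: by the chain rule here, and
      through the cusp model below, where the derivative at 0 is zero. Injectivity of
      \<open>E\<close> and \<open>D\<close> then forces \<open>f1 0 = 0\<close>.\<close>
    have "((\<lambda>t. \<Psi> (f (\<phi> t))) has_derivative (\<lambda>h. E (D h *\<^sub>R f1 0))) (at 0)"
      using diff_chain_at[OF diff_chain_at[OF D(1)], of f "\<lambda>h. h *\<^sub>R f1 0" \<Psi> E] f0 E(1)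
      by (simp add: \<phi>0 o_def)
    moreover have "((\<lambda>t. \<Psi> (f (\<phi> t))) has_derivative (\<lambda>h. 0)) (at 0)"
    proof -
      have c: "(\<lambda>t::real. vector [t^2, t^3] :: real^2)
          = (\<lambda>t. t^2 *\<^sub>R axis 1 1 + t^3 *\<^sub>R axis 2 1)"
        by (rule ext) (simp add: vec_eq_iff forall_2 axis_def)
      have "((\<lambda>t::real. vector [t^2, t^3] :: real^2) has_derivative (\<lambda>h. 0)) (at 0)"
        unfolding c by (auto intro!: derivative_eq_intros)
      then have "((\<lambda>t::real. vector [t^2, t^3] :: real^2) has_vector_derivative 0) (at 0)"
        by (simp add: has_vector_derivative_def)
      from has_vector_derivative_eventually_eq[OF this eq] show ?thesis
        by (simp add: has_vector_derivative_def)
    qed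
    ultimately have "(\<lambda>h. E (D h *\<^sub>R f1 0)) = (\<lambda>h. 0)"
      by (rule has_derivative_unique)
    then have "E (D 1 *\<^sub>R f1 0) = E 0"
      using has_derivative_bounded_linear[OF E(1)]
      by (simp add: fun_eq_iff bounded_linear.linear linear_0)
    then have "D 1 *\<^sub>R f1 0 = 0" using E(2) by (simp add: inj_eq)
    moreover have "D 1 \<noteq> 0"
      using D has_derivative_bounded_linear[OF D(1)]
      by (metis bounded_linear.linear linear_0 inj_eq zero_neq_one)
    ultimately show ?thesis by simp
  qed
  show "f2 \<noteq> 0"
  proof
    assume "f2 = 0"
    obtain C where C: "C > 0" "\<forall>\<^sub>F x in nhds (f 0). norm (\<Psi> x - \<Psi> (f 0)) \<le> C * norm (x - f 0)"
      using has_derivative_Lipschitz_at[OF E(1)] .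
    obtain K where K: "K > 0" "\<forall>\<^sub>F t in nhds 0. norm (\<phi> t - \<phi> 0) \<le> K * norm (t - 0)"
      using has_derivative_Lipschitz_at[OF D(1)] .
    \<comment> \<open>Chosen so that \<open>C * \<epsilon> * K\<^sup>2 = 1/2\<close>: the estimates
      then yield \<open>t\<^sup>2 \<le> t\<^sup>2 / 2\<close> near 0.\<close>
    define \<epsilon> where "\<epsilon> = 1 / (2 * C * K\<^sup>2)"
    have "\<epsilon> > 0" using C K by (simp add: \<epsilon>_def)
    have lim_\<phi>: "filterlim \<phi> (nhds 0) (nhds 0)"
      using has_derivative_continuous[OF D(1)] \<phi>0 isCont_def tendsto_at_iff_tendsto_nhds by metis
    have lim_f: "filterlim f (nhds (f 0)) (nhds 0)"
      using has_derivative_continuous[OF f0] isCont_def tendsto_at_iff_tendsto_nhds by metis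
    have 1: "\<forall>\<^sub>F t in nhds 0. norm (f (\<phi> t) - f 0) \<le> \<epsilon> * (\<phi> t)\<^sup>2"
      using second_order_vanishing[OF f1 _ f10 \<open>\<epsilon> > 0\<close>] f2 \<open>f2 = 0\<close>
        eventually_compose_filterlim lim_\<phi> by blast
    have 2: "\<forall>\<^sub>F t in nhds 0. norm (\<Psi> (f (\<phi> t)) - \<Psi> (f 0)) \<le> C * norm (f (\<phi> t) - f 0)"
      using eventually_compose_filterlim[OF C(2) filterlim_compose[OF lim_f lim_\<phi>]] .
    have "\<forall>\<^sub>F t::real in nhds 0. t = 0"
      using 1 2 K(2) eq
    proof eventually_elim
      case (elim t)
      have "t\<^sup>2 = \<bar>(vector [t^2, t^3] :: real^2) $ 1\<bar>" by simp
      also have "\<dots> \<le> norm (\<Psi> (f (\<phi> t)))"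
        unfolding elim(4) by (rule component_le_norm_cart)
      also have "\<dots> \<le> C * (\<epsilon> * (\<phi> t)\<^sup>2)"
        using elim(1,2) C(1) \<Psi>0 by (auto intro: order_trans mult_left_mono)
      also have "(\<phi> t)\<^sup>2 \<le> (K * \<bar>t\<bar>)\<^sup>2"
        using elim(3) \<phi>0 K(1) by (simp add: abs_le_square_iff[symmetric] abs_mult)
      then have "C * (\<epsilon> * (\<phi> t)\<^sup>2) \<le> C * (\<epsilon> * (K * \<bar>t\<bar>)\<^sup>2)"
        using C(1) \<open>\<epsilon> > 0\<close> by (simp add: mult_left_mono)
      also have "\<dots> = t\<^sup>2 / 2"
        using C(1) K(1) by (simp add: \<epsilon>_def field_simps power_mult_distrib)
      finally show ?case by simp
    qed
    \<comment> \<open>The contradiction is that 0 is not an isolated point of the real line.\<close>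
    then have "\<forall>\<^sub>F t::real in at 0. False"
      by (auto simp: eventually_at_filter elim: eventually_mono)
    then show False by simp
  qed
qed

lemma det2_eq: "det2 v w = v$1 * w$2 - v$2 * w$1"
  by (simp add: det2_def det_2 vector_2)

lemma unit_dir_has_vector_derivative:
  "((\<lambda>u. unit_dir (u + c)) has_vector_derivative unit_dir (u + c + pi/2)) (at u)"
proof -
  have *: "unit_dir = (\<lambda>\<alpha>. cos \<alpha> *\<^sub>R axis 1 1 + sin \<alpha> *\<^sub>R axis 2 1)"
    by (rule ext) (simp add: unit_dir_def vec_eq_iff forall_2 axis_def)
  show ?thesis
    unfolding * has_vector_derivative_def
    by (auto intro!: derivative_eq_intros simp: cos_add sin_add algebra_simps fun_eq_iff)
qed

text \<open>Splits the exponent as 2 + 1/2. The square will cancel against the determinant, leaving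
  the single square root in the curvature formula.\<close>

lemma abs_powr_five_halves: "\<bar>x::real\<bar> powr (5/2) = x\<^sup>2 * sqrt \<bar>x\<bar>"
proof (cases "x = 0")
  case False
  have "\<bar>x\<bar> powr (2 + 1/2) = \<bar>x\<bar> powr 2 * \<bar>x\<bar> powr (1/2)" by (rule powr_add)
  with False show ?thesis by (simp add: powr_half_sqrt)
qed simp

theorem proposition3p10:
  fixes \<gamma>p \<gamma>m \<Delta> S :: "real \<Rightarrow> real^2"
    and \<rho>p \<rho>m \<Sigma>\<rho> J \<mu> :: "real \<Rightarrow> real"
    and \<theta>0 :: real
  assumes "angularly_regular_parallel_pair \<gamma>p \<gamma>m \<rho>p \<rho>m \<theta>0"
    and "\<Sigma>\<rho> = (\<lambda>u. \<rho>p u + \<rho>m u)"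
    and "\<Delta> = (\<lambda>u. \<gamma>p u - \<gamma>m u)"
    and "J = (\<lambda>u. \<rho>p u * deriv \<rho>m u - \<rho>m u * deriv \<rho>p u)"
    and "\<mu> = (\<lambda>u. \<rho>m u / \<Sigma>\<rho> u)"
    and "S = (\<lambda>u. \<gamma>m u + \<mu> u *\<^sub>R \<Delta> u)"
    and "det2 (\<Delta> 0) (unit_dir \<theta>0) \<noteq> 0"
    and "\<Sigma>\<rho> 0 \<noteq> 0"
    and "three_halves_cusp S"
  shows "has_cuspidal_curvature S
           (2 * \<Sigma>\<rho> 0 * det2 (\<Delta> 0) (unit_dir \<theta>0)
             / (sqrt \<bar>(deriv ^^ 2) \<mu> 0\<bar> * norm (\<Delta> 0) powr (5/2)))
         \<and> (deriv ^^ 2) \<mu> 0 = deriv J 0 / (\<Sigma>\<rho> 0)^2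
         \<and> (deriv ^^ 2) \<mu> 0 \<noteq> 0"
proof -
  note \<Sigma> = assms(2) and \<Delta> = assms(3) and J = assms(4) and \<mu> = assms(5) and S = assms(6)

  \<comment> \<open>Derivatives of the curves and radii\<close>
  define e where "e = (\<lambda>u. unit_dir (u + \<theta>0))"
  define e1 where "e1 = (\<lambda>u. unit_dir (u + \<theta>0 + pi/2))"
  have e: "(e has_vector_derivative e1 u) (at u)" for u
    unfolding e_def e1_def by (rule unit_dir_has_vector_derivative)
  have pair: "smooth_germ \<gamma>p 0" "smooth_germ \<gamma>m 0" "smooth_germ \<rho>p 0" "smooth_germ \<rho>m 0"
     "\<forall>\<^sub>F u in nhds 0. vderiv \<gamma>p u = \<rho>p u *\<^sub>R e u \<and> vderiv \<gamma>m u = - \<rho>m u *\<^sub>R e u"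
    using assms(1) unfolding angularly_regular_parallel_pair_def angularly_regular_def
      cooriented_frontal_def e_def by auto
  \<comment> \<open>Three derivatives of each radius are taken because \<open>\<mu>2\<close>
    contains second derivatives and must itself be differentiated at 0.\<close>
  obtain p1 where p1: "smooth_germ p1 0" "\<forall>\<^sub>F u in nhds 0. (\<rho>p has_real_derivative p1 u) (at u)"
    using smooth_germ_real_derivative[OF pair(3)] .
  obtain p2 where p2: "smooth_germ p2 0" "\<forall>\<^sub>F u in nhds 0. (p1 has_real_derivative p2 u) (at u)"
    using smooth_germ_real_derivative[OF p1(1)] .
  obtain p3 where p3: "smooth_germ p3 0" "\<forall>\<^sub>F u in nhds 0. (p2 has_real_derivative p3 u) (at u)"
    using smooth_germ_real_derivative[OF p2(1)] .
  obtain m1 where m1: "smooth_germ m1 0" "\<forall>\<^sub>F u in nhds 0. (\<rho>m has_real_derivative m1 u) (at u)"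
    using smooth_germ_real_derivative[OF pair(4)] .
  obtain m2 where m2: "smooth_germ m2 0" "\<forall>\<^sub>F u in nhds 0. (m1 has_real_derivative m2 u) (at u)"
    using smooth_germ_real_derivative[OF m1(1)] .
  obtain m3 where m3: "smooth_germ m3 0" "\<forall>\<^sub>F u in nhds 0. (m2 has_real_derivative m3 u) (at u)"
    using smooth_germ_real_derivative[OF m2(1)] .
  have \<gamma>p: "\<forall>\<^sub>F u in nhds 0. (\<gamma>p has_vector_derivative \<rho>p u *\<^sub>R e u) (at u)"
  proof -
    obtain g where "\<forall>\<^sub>F u in nhds 0. (\<gamma>p has_vector_derivative g u) (at u)"
      using smooth_germ_vector_derivative[OF pair(1)] .
    then show ?thesis using pair(5)
      by eventually_elim (metis vderiv_def vector_derivative_at)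
  qed
  have \<gamma>m: "\<forall>\<^sub>F u in nhds 0. (\<gamma>m has_vector_derivative - \<rho>m u *\<^sub>R e u) (at u)"
  proof -
    obtain g where "\<forall>\<^sub>F u in nhds 0. (\<gamma>m has_vector_derivative g u) (at u)"
      using smooth_germ_vector_derivative[OF pair(2)] .
    then show ?thesis using pair(5)
      by eventually_elim (metis vderiv_def vector_derivative_at)
  qed
  have \<Delta>1: "\<forall>\<^sub>F u in nhds 0. (\<Delta> has_vector_derivative \<Sigma>\<rho> u *\<^sub>R e u) (at u)"
    using \<gamma>p \<gamma>m unfolding \<Delta>
    by eventually_elim (auto intro!: derivative_eq_intros simp: \<Sigma> algebra_simps)
  define s1 where "s1 = (\<lambda>u. p1 u + m1 u)"
  have \<Sigma>1: "\<forall>\<^sub>F u in nhds 0. (\<Sigma>\<rho> has_real_derivative s1 u) (at u)"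
    using p1(2) m1(2) unfolding \<Sigma> s1_def by eventually_elim (auto intro!: derivative_eq_intros)
  have \<Sigma>nz: "\<forall>\<^sub>F u in nhds 0. \<Sigma>\<rho> u \<noteq> 0"
  proof -
    have "isCont \<Sigma>\<rho> 0" using eventually_nhds_x_imp_x[OF \<Sigma>1] DERIV_isCont by blast
    then show ?thesis
      using assms(8) isCont_def tendsto_at_iff_tendsto_nhds tendsto_imp_eventually_ne by metis
  qed

  \<comment> \<open>The ratio \<open>\<mu>\<close> and its derivatives\<close>
  define j where "j = (\<lambda>u. \<rho>p u * m1 u - \<rho>m u * p1 u)"
  \<comment> \<open>The products \<open>p1 u * m1 u\<close> cancel in the derivative of
    \<open>j\<close>.\<close>
  define j1 where "j1 = (\<lambda>u. \<rho>p u * m2 u - \<rho>m u * p2 u)"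
  have j: "\<forall>\<^sub>F u in nhds 0. (j has_real_derivative j1 u) (at u)"
    using p1(2) m1(2) p2(2) m2(2) unfolding j_def j1_def
    by eventually_elim (auto intro!: derivative_eq_intros simp: algebra_simps)
  have Jj: "\<forall>\<^sub>F u in nhds 0. J u = j u"
    using p1(2) m1(2) unfolding J j_def by eventually_elim (simp add: DERIV_imp_deriv)
  have dJ: "deriv J 0 = j1 0"
    using eventually_nhds_x_imp_x[OF deriv_eventually[OF Jj j]] .
  define \<mu>1 where "\<mu>1 = (\<lambda>u. j u / (\<Sigma>\<rho> u)\<^sup>2)"
  have \<mu>1: "\<forall>\<^sub>F u in nhds 0. (\<mu> has_real_derivative \<mu>1 u) (at u)"
    using p1(2) m1(2) \<Sigma>nz unfolding \<mu> \<mu>1_def j_def \<Sigma>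
    by eventually_elim (auto intro!: derivative_eq_intros simp: power2_eq_square algebra_simps)
  define \<mu>2 where "\<mu>2 = (\<lambda>u. j1 u / (\<Sigma>\<rho> u)\<^sup>2 - 2 * j u * s1 u / (\<Sigma>\<rho> u)^3)"
  have \<mu>2: "\<forall>\<^sub>F u in nhds 0. (\<mu>1 has_real_derivative \<mu>2 u) (at u)"
    using j \<Sigma>1 \<Sigma>nz unfolding \<mu>1_def \<mu>2_def
    by eventually_elim (auto intro!: derivative_eq_intros simp: divide_simps power2_eq_square
        power3_eq_cube algebra_simps)
  \<comment> \<open>Existence is enough here: in \<open>S3\<close> this number multiplies
    \<open>\<Delta> 0\<close>, which is parallel to \<open>S2 0\<close> at the cusp, so it drops out
    of the determinant.\<close>
  obtain \<mu>3 where \<mu>3: "(\<mu>2 has_real_derivative \<mu>3) (at 0)"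
  proof -
    note D = eventually_nhds_x_imp_x[OF p1(2)] eventually_nhds_x_imp_x[OF p2(2)]
      eventually_nhds_x_imp_x[OF p3(2)] eventually_nhds_x_imp_x[OF m1(2)]
      eventually_nhds_x_imp_x[OF m2(2)] eventually_nhds_x_imp_x[OF m3(2)]
      eventually_nhds_x_imp_x[OF j] eventually_nhds_x_imp_x[OF \<Sigma>1]
    have "\<mu>2 field_differentiable (at 0)"
      using assms(8) D unfolding \<mu>2_def j1_def s1_def
      by (intro derivative_intros) (auto simp: field_differentiable_def)
    then show ?thesis using that by (auto simp: field_differentiable_def)
  qed
  have d\<mu>: "(deriv ^^ 2) \<mu> 0 = \<mu>2 0"
    using eventually_nhds_x_imp_x[OF deriv_eventually[OF deriv_eventually[OF _ \<mu>1] \<mu>2]]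
    by (simp add: numeral_2_eq_2)

  \<comment> \<open>Derivatives of \<open>S\<close> up to order three\<close>
  define S1 where "S1 = (\<lambda>u. \<mu>1 u *\<^sub>R \<Delta> u)"
  define S2 where "S2 = (\<lambda>u. \<mu>2 u *\<^sub>R \<Delta> u + (\<mu>1 u * \<Sigma>\<rho> u) *\<^sub>R e u)"
  \<comment> \<open>The factor 2 collects one term from \<open>\<mu>2 *\<^sub>R \<Delta>\<close> and
    one from differentiating \<open>\<mu>1\<close> in the coefficient of \<open>e\<close>. The last
    summand carries \<open>\<mu>1 0\<close>, which is zero at the cusp.\<close>
  define S3 where "S3 = \<mu>3 *\<^sub>R \<Delta> 0 + 2 *\<^sub>R (\<mu>2 0 * \<Sigma>\<rho> 0) *\<^sub>R e 0
    + \<mu>1 0 *\<^sub>R (s1 0 *\<^sub>R e 0 + \<Sigma>\<rho> 0 *\<^sub>R e1 0)"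
  have S1: "\<forall>\<^sub>F u in nhds 0. (S has_vector_derivative S1 u) (at u)"
    using \<gamma>m \<Delta>1 \<mu>1 \<Sigma>nz
  proof eventually_elim
    case (elim u)
    \<comment> \<open>Thus the term \<open>\<mu> u *\<^sub>R \<Sigma>\<rho> u *\<^sub>R e u\<close>
      coming from the derivative of \<open>\<Delta>\<close> cancels the velocity of
      \<open>\<gamma>m\<close>.\<close>
    have "\<mu> u * \<Sigma>\<rho> u = \<rho>m u" using elim(4) by (simp add: \<mu>)
    then have "\<mu> u *\<^sub>R \<Sigma>\<rho> u *\<^sub>R e u = \<rho>m u *\<^sub>R e u" by simp
    with elim show ?case unfolding S S1_def
      by (auto intro!: derivative_eq_intros)
  qed
  have S2: "\<forall>\<^sub>F u in nhds 0. (S1 has_vector_derivative S2 u) (at u)"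
    using \<Delta>1 \<mu>2 unfolding S1_def S2_def
    by eventually_elim (auto intro!: derivative_eq_intros)
  have S3: "(S2 has_vector_derivative S3) (at 0)"
    using eventually_nhds_x_imp_x[OF \<Delta>1] eventually_nhds_x_imp_x[OF \<mu>2]
      eventually_nhds_x_imp_x[OF \<Sigma>1] \<mu>3 e[of 0] unfolding S2_def S3_def
    by (auto intro!: derivative_eq_intros simp: vec_eq_iff algebra_simps)
  have dS1: "\<forall>\<^sub>F u in nhds 0. vderiv S u = S1 u" by (rule vderiv_eventually[OF _ S1]) simp
  have dS2: "\<forall>\<^sub>F u in nhds 0. vderiv (vderiv S) u = S2 u" by (rule vderiv_eventually[OF dS1 S2])
  have dS3: "vderiv (vderiv (vderiv S)) 0 = S3"
    unfolding vderiv_def[of "vderiv (vderiv S)"]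
    by (intro vector_derivative_at has_vector_derivative_eventually_eq[OF S3 dS2])

  \<comment> \<open>Evaluation at the cusp\<close>
  have "S1 0 = 0" and S20: "S2 0 \<noteq> 0"
    using three_halves_cusp_derivatives[OF assms(9) S1 eventually_nhds_x_imp_x[OF S2]] by auto
  have "\<Delta> 0 \<noteq> 0" using assms(7) by (auto simp: det2_eq)
  with \<open>S1 0 = 0\<close> have \<mu>10: "\<mu>1 0 = 0" by (simp add: S1_def)
  then have "j 0 = 0" using assms(8) by (simp add: \<mu>1_def)
  have S2': "S2 0 = \<mu>2 0 *\<^sub>R \<Delta> 0" using \<mu>10 by (simp add: S2_def)
  have \<mu>20: "\<mu>2 0 \<noteq> 0" using S20 S2' by auto
  \<comment> \<open>One factor \<open>\<mu>2 0\<close> comes from \<open>S2 0\<close>, the other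
    from the \<open>e 0\<close> term of \<open>S3\<close>; the square makes the sign of the
    curvature independent of the sign of \<open>\<mu>2 0\<close>.\<close>
  have "det2 (S2 0) S3 = (\<mu>2 0)\<^sup>2 * (2 * \<Sigma>\<rho> 0 * det2 (\<Delta> 0) (unit_dir \<theta>0))"
    by (simp add: S2' S3_def \<mu>10 det2_eq e_def power2_eq_square algebra_simps)
  moreover have "norm (S2 0) powr (5/2) = (\<mu>2 0)\<^sup>2 * (sqrt \<bar>\<mu>2 0\<bar> * norm (\<Delta> 0) powr (5/2))"
    by (simp add: S2' powr_mult abs_powr_five_halves)
  ultimately have "det2 (S2 0) S3 / norm (S2 0) powr (5/2)
      = 2 * \<Sigma>\<rho> 0 * det2 (\<Delta> 0) (unit_dir \<theta>0) / (sqrt \<bar>\<mu>2 0\<bar> * norm (\<Delta> 0) powr (5/2))"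
    using \<mu>20 by simp
  then have "has_cuspidal_curvature S (2 * \<Sigma>\<rho> 0 * det2 (\<Delta> 0) (unit_dir \<theta>0)
      / (sqrt \<bar>\<mu>2 0\<bar> * norm (\<Delta> 0) powr (5/2)))"
    using eventually_nhds_x_imp_x[OF dS1] eventually_nhds_x_imp_x[OF dS2] dS3 S20 \<open>S1 0 = 0\<close>
    by (simp add: has_cuspidal_curvature_def numeral_2_eq_2 numeral_3_eq_3)
  \<comment> \<open>The quotient-rule correction in \<open>\<mu>2\<close> contains
    \<open>j 0\<close>, which vanishes because \<open>\<mu>1 0 = 0\<close>.\<close>
  moreover have "\<mu>2 0 = deriv J 0 / (\<Sigma>\<rho> 0)\<^sup>2"
    by (simp add: dJ \<mu>2_def \<open>j 0 = 0\<close>)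
  ultimately show ?thesis using \<mu>20 by (simp add: d\<mu>)
qed

end
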